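(* Let $\alpha\in[0,1)$. Assume that for (almost) every realization of the histories $H=\{b_k,\pi,z\}$ and $H'=\{b_k,\pi',z'\}$ the bounds satisfy $$P\left(l\le g\le u \mid H,\nu\right)\ \ge\ 1-\alpha \qquad\text{and}\qquad P\left(l'\le g'\le u' \mid H',\nu\right)\ \ge\ 1-\alpha .$$ For $\Delta\in\mathbb R$ put $$\beta(\Delta)=\min\left\{1,\ \frac{P\left(\bar{\mathcal L}>\Delta\mid b_k,\pi,\pi',\nu\right)}{(1-\alpha)^2}+2\alpha-\alpha^2\right\}.$$ Then for every $\Delta\in\mathbb R$, $$P\left(\mathcal L>\Delta\mid b_k,\pi,\pi',\nu\right)\ \le\ \beta(\Delta)\qquad\text{and}\qquad P\left(\mathcal L\le\Delta\mid b_k,\pi,\pi',\nu\right)\ \ge\ 1-\beta(\Delta).$$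
   Context: Setting (probabilistic $\rho$-POMDP with simplification). State, action and observation spaces $\mathcal X,\mathcal A,\mathcal Z$ are given, with a stochastic transition model and a stochastic observation model. The belief update is stochastic, with law $\mathbb P_B(b_\ell\mid b_{\ell-1},\pi_{\ell-1},z_\ell)$, and the reward is stochastic, with law $\mathbb P_R(\rho_\ell\mid b_\ell,\pi_{\ell-1}(b_{\ell-1}))$ (either may be a Dirac measure). Fix the current belief $b_k$, a planning horizon $L$, two candidate policy sequences $\pi=\pi_{k:k+L-1}$ and $\pi'=\pi'_{k:k+L-1}$, and a simplification operator $\nu$, which replaces beliefs, belief updates and rewards by simplified (possibly random) versions but does not affect the law of the observations. Random variables, for fixed $(b_k,\pi,\pi',\nu)$: - $z=z_{k+1:k+L}$ and $z'=z'_{k+1:k+L}$ are the future observation sequences under $\pi$ and $\pi'$, with joint law $\mathbb P(z,z'\mid b_k,\pi,\pi')$ ($z$ and $z'$ may be dependent). - The histories are $H=\{b_k,\pi,z\}$ and $H'=\{b_k,\pi',z'\}$. - $g$ and $g'$ are the real-valued original returns under $\pi$ and $\pi'$ (a return is a known function of the rewards $\rho_{k+1:k+L}$, e.g. their sum). - $\breve g$ and $\breve g'$ are the corresponding real-valued simplified returns. - $l,u$ and $l',u'$ are real random variables, serving as lower and upper bounds for $g$ and $g'$, respectively. Structural property of the model: conditionally on $(z,z')$, the tuples $(g,\breve g,l,u)$ and $(g',\breve g',l',u')$ are independent, and each depends only on its own history, i.e. $$\mathbb P(g,g',\breve g,\breve g',l,u,l',u'\mid H,H',\nu)=\mathbb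 P(g,\breve g,l,u\mid H,\nu)\,\mathbb P(g',\breve g',l',u'\mid H',\nu).$$ The probability $P(\,\cdot\mid b_k,\pi,\pi',\nu)$ is the joint law obtained by integrating this over $\mathbb P(z,z'\mid b_k,\pi,\pi')$. Loss: $$\mathcal L=\begin{cases}\max\{g'-g,0\} & \text{if } \breve g-\breve g'>0,\\ \max\{g-g',0\} & \text{if } \breve g-\breve g'<0,\\ 0&\text{otherwise.}\end{cases}$$ Bound on the loss: $$\bar{\mathcal L}=\begin{cases}\max\{u'-l,0\} & \text{if } \breve g-\breve g'>0,\\ \max\{u-l',0\} & \text{if } \breve g-\breve g'<0,\\ 0&\text{otherwise.}\end{cases}$$ *)

theory Defs
  imports "HOL-Probability.Probability"
begin

section \<open>The decision model\<close>

text \<open>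
  Beliefs are probability measures on the state space. The observation kernel may also depend on
  the last action. The belief update takes the policy \<open>\<pi>\<^sub>l\<^sub>-\<^sub>1\<close> itself as an argument, as in
  \<open>P(b\<^sub>l | b\<^sub>l\<^sub>-\<^sub>1, \<pi>\<^sub>l\<^sub>-\<^sub>1, z\<^sub>l)\<close>.
\<close>

record ('x, 'a, 'z) rho_pomdp =
  state_space :: "'x measure"
  action_space :: "'a measure"
  observation_space :: "'z measure"
  transition :: "'x \<times> 'a \<Rightarrow> 'x measure"
  observation :: "'x \<times> 'a \<Rightarrow> 'z measure"
  belief_update :: "('x measure \<Rightarrow> 'a) \<Rightarrow> 'x measure \<times> 'z \<Rightarrow> 'x measure measure"
  reward :: "'x measure \<times> 'a \<Rightarrow> real measure"

definition belief_space :: "('x, 'a, 'z) rho_pomdp \<Rightarrow> 'x measure measure" where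
  "belief_space M = prob_algebra (state_space M)"

definition rho_pomdp :: "('x, 'a, 'z) rho_pomdp \<Rightarrow> bool" where
  "rho_pomdp M \<longleftrightarrow>
     transition M \<in> state_space M \<Otimes>\<^sub>M action_space M \<rightarrow>\<^sub>M prob_algebra (state_space M) \<and>
     observation M \<in> state_space M \<Otimes>\<^sub>M action_space M \<rightarrow>\<^sub>M prob_algebra (observation_space M) \<and>
     (\<forall>p \<in> belief_space M \<rightarrow>\<^sub>M action_space M.
        belief_update M p \<in> belief_space M \<Otimes>\<^sub>M observation_space M
          \<rightarrow>\<^sub>M prob_algebra (belief_space M)) \<and>
     reward M \<in> belief_space M \<Otimes>\<^sub>M action_space M \<rightarrow>\<^sub>M prob_algebra borel"

type_synonym ('x, 'a) policies = "nat \<Rightarrow> 'x measure \<Rightarrow> 'a"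

type_synonym ('x, 'a, 'z) history = "'x measure \<times> ('x, 'a) policies \<times> (nat \<Rightarrow> 'z)"

type_synonym 'x belief_rewards = "(nat \<Rightarrow> 'x measure) \<times> (nat \<Rightarrow> real)"

definition policy_sequence ::
  "('x, 'a, 'z) rho_pomdp \<Rightarrow> nat \<Rightarrow> nat \<Rightarrow> ('x, 'a) policies \<Rightarrow> bool" where
  "policy_sequence M k L \<pi> \<longleftrightarrow> (\<forall>l\<in>{k..<k+L}. \<pi> l \<in> belief_space M \<rightarrow>\<^sub>M action_space M)"

definition obs_seqs :: "('x, 'a, 'z) rho_pomdp \<Rightarrow> nat \<Rightarrow> nat \<Rightarrow> (nat \<Rightarrow> 'z) measure" where
  "obs_seqs M k L = (\<Pi>\<^sub>M l\<in>{k+1..k+L}. observation_space M)"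

definition reward_seqs :: "nat \<Rightarrow> nat \<Rightarrow> (nat \<Rightarrow> real) measure" where
  "reward_seqs k L = (\<Pi>\<^sub>M l\<in>{k+1..k+L}. borel)"

definition belief_reward_seqs ::
  "('x, 'a, 'z) rho_pomdp \<Rightarrow> nat \<Rightarrow> nat \<Rightarrow> 'x belief_rewards measure" where
  "belief_reward_seqs M k L = (\<Pi>\<^sub>M l\<in>{k..k+L}. belief_space M) \<Otimes>\<^sub>M reward_seqs k L"

text \<open>
  Joint law of the final state \<open>x\<^bsub>k+n\<^esub>\<close> and of the observations, beliefs and rewards after
  \<open>n\<close> steps, started with \<open>x\<^sub>k\<close> drawn from the current belief.
\<close>

primrec process ::
  "('x, 'a, 'z) rho_pomdp \<Rightarrow> nat \<Rightarrow> 'x measure \<Rightarrow> ('x, 'a) policies \<Rightarrow> nat \<Rightarrow>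
   ('x \<times> (nat \<Rightarrow> 'z) \<times> 'x belief_rewards) measure" where
  "process M k bk \<pi> 0 =
     distr bk (state_space M \<Otimes>\<^sub>M obs_seqs M k 0 \<Otimes>\<^sub>M belief_reward_seqs M k 0)
       (\<lambda>x. (x, (\<lambda>_. undefined), (\<lambda>_. undefined)(k := bk), (\<lambda>_. undefined)))"
| "process M k bk \<pi> (Suc n) =
     process M k bk \<pi> n \<bind> (\<lambda>(x, z, b, r).
     transition M (x, \<pi> (k+n) (b (k+n))) \<bind> (\<lambda>x1.
     observation M (x1, \<pi> (k+n) (b (k+n))) \<bind> (\<lambda>z1.
     belief_update M (\<pi> (k+n)) (b (k+n), z1) \<bind> (\<lambda>b1.
     reward M (b1, \<pi> (k+n) (b (k+n))) \<bind> (\<lambda>r1.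
     return (state_space M \<Otimes>\<^sub>M obs_seqs M k (Suc n) \<Otimes>\<^sub>M belief_reward_seqs M k (Suc n))
       (x1, z(k + Suc n := z1), b(k + Suc n := b1), r(k + Suc n := r1)))))))"

lemma process_step_measurable:
  assumes M: "rho_pomdp M" and p: "\<pi> (k+n) \<in> belief_space M \<rightarrow>\<^sub>M action_space M"
  shows "(\<lambda>(x, z, b, r).
     transition M (x, \<pi> (k+n) (b (k+n))) \<bind> (\<lambda>x1.
     observation M (x1, \<pi> (k+n) (b (k+n))) \<bind> (\<lambda>z1.
     belief_update M (\<pi> (k+n)) (b (k+n), z1) \<bind> (\<lambda>b1.
     reward M (b1, \<pi> (k+n) (b (k+n))) \<bind> (\<lambda>r1.
     return (state_space M \<Otimes>\<^sub>M obs_seqs M k (Suc n) \<Otimes>\<^sub>M belief_reward_seqs M k (Suc n))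
       (x1, z(k + Suc n := z1), b(k + Suc n := b1), r(k + Suc n := r1))))))) \<in>
   state_space M \<Otimes>\<^sub>M obs_seqs M k n \<Otimes>\<^sub>M belief_reward_seqs M k n \<rightarrow>\<^sub>M
   prob_algebra (state_space M \<Otimes>\<^sub>M obs_seqs M k (Suc n) \<Otimes>\<^sub>M belief_reward_seqs M k (Suc n))"
proof -
  note [measurable] = p
  have [measurable]: "transition M \<in> state_space M \<Otimes>\<^sub>M action_space M \<rightarrow>\<^sub>M prob_algebra (state_space M)"
     "observation M \<in> state_space M \<Otimes>\<^sub>M action_space M \<rightarrow>\<^sub>M prob_algebra (observation_space M)"
     "belief_update M (\<pi> (k+n)) \<in> belief_space M \<Otimes>\<^sub>M observation_space M \<rightarrow>\<^sub>M prob_algebra (belief_space M)"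
     "reward M \<in> belief_space M \<Otimes>\<^sub>M action_space M \<rightarrow>\<^sub>M prob_algebra borel"
    using M p unfolding rho_pomdp_def by auto
  have e1: "{k+1..k+Suc n} = insert (k+Suc n) {k+1..k+n}" "{k..k+Suc n} = insert (k+Suc n) {k..k+n}" by auto
  have [measurable]: "k + n \<in> {k..k+n}" by auto
  show ?thesis
    unfolding obs_seqs_def belief_reward_seqs_def reward_seqs_def e1
    by measurable
qed

lemma process_in_prob_algebra:
  assumes M: "rho_pomdp M" and bk: "bk \<in> space (belief_space M)"
   and p: "\<And>l. l \<in> {k..<k+n} \<Longrightarrow> \<pi> l \<in> belief_space M \<rightarrow>\<^sub>M action_space M"
  shows "process M k bk \<pi> n \<in>
    space (prob_algebra (state_space M \<Otimes>\<^sub>M obs_seqs M k n \<Otimes>\<^sub>M belief_reward_seqs M k n))"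
  using p
proof (induction n)
  case 0
  have s: "sets bk = sets (state_space M)" "prob_space bk"
    using bk by (auto simp: belief_space_def space_prob_algebra)
  have b: "(\<lambda>_. undefined)(k := bk) \<in> space (\<Pi>\<^sub>M l\<in>{k..k+0}. belief_space M)"
    using bk by (auto simp: space_PiM PiE_iff extensional_def)
  have z: "(\<lambda>_. undefined) \<in> space (obs_seqs M k 0)" "(\<lambda>_. undefined) \<in> space (reward_seqs k 0)"
    by (auto simp: obs_seqs_def reward_seqs_def space_PiM)
  have "(\<lambda>x. (x, (\<lambda>_. undefined), (\<lambda>_. undefined)(k := bk), (\<lambda>_. undefined)))
      \<in> bk \<rightarrow>\<^sub>M state_space M \<Otimes>\<^sub>M obs_seqs M k 0 \<Otimes>\<^sub>M belief_reward_seqs M k 0"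
    unfolding belief_reward_seqs_def
    using b z by (intro measurable_Pair measurable_const measurable_ident_sets[OF s(1)])
      (simp_all add: space_pair_measure)
  then show ?case using s by (simp add: space_prob_algebra prob_space.prob_space_distr)
next
  case (Suc n)
  have IH: "process M k bk \<pi> n \<in>
      space (prob_algebra (state_space M \<Otimes>\<^sub>M obs_seqs M k n \<Otimes>\<^sub>M belief_reward_seqs M k n))"
    using Suc by auto
  have p: "\<pi> (k+n) \<in> belief_space M \<rightarrow>\<^sub>M action_space M"
    by (rule Suc.prems) simp
  note step = IH process_step_measurable[of M \<pi> k n, OF M p]
  show ?case
    using prob_space_bind'[OF step] sets_bind'[OF step]
    by (simp only: process.simps space_prob_algebra mem_Collect_eq)
qed

definition trajectory_law ::
  "('x, 'a, 'z) rho_pomdp \<Rightarrow> nat \<Rightarrow> nat \<Rightarrow> 'x measure \<Rightarrow> ('x, 'a) policies \<Rightarrow>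
   ((nat \<Rightarrow> 'z) \<times> 'x belief_rewards) measure" where
  "trajectory_law M k L bk \<pi> =
     distr (process M k bk \<pi> L) (obs_seqs M k L \<Otimes>\<^sub>M belief_reward_seqs M k L) snd"

definition obs_law ::
  "('x, 'a, 'z) rho_pomdp \<Rightarrow> nat \<Rightarrow> nat \<Rightarrow> 'x measure \<Rightarrow> ('x, 'a) policies \<Rightarrow>
   (nat \<Rightarrow> 'z) measure" where
  "obs_law M k L bk \<pi> = distr (trajectory_law M k L bk \<pi>) (obs_seqs M k L) fst"

text \<open>
  The joint law of the two observation sequences is only constrained through its marginals: the
  sequences may be dependent.
\<close>

definition joint_obs_law ::
  "('x, 'a, 'z) rho_pomdp \<Rightarrow> nat \<Rightarrow> nat \<Rightarrow> 'x measure \<Rightarrow> ('x, 'a) policies \<Rightarrow>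
   ('x, 'a) policies \<Rightarrow> ((nat \<Rightarrow> 'z) \<times> (nat \<Rightarrow> 'z)) measure \<Rightarrow> bool" where
  "joint_obs_law M k L bk \<pi> \<pi>' Q \<longleftrightarrow>
     Q \<in> space (prob_algebra (obs_seqs M k L \<Otimes>\<^sub>M obs_seqs M k L)) \<and>
     distr Q (obs_seqs M k L) fst = obs_law M k L bk \<pi> \<and>
     distr Q (obs_seqs M k L) snd = obs_law M k L bk \<pi>'"

text \<open>
  \<open>R\<close> is a regular conditional law of the original beliefs and rewards given the history.
\<close>

definition conditional_law ::
  "('x, 'a, 'z) rho_pomdp \<Rightarrow> nat \<Rightarrow> nat \<Rightarrow> 'x measure \<Rightarrow> ('x, 'a) policies \<Rightarrow>
   (('x, 'a, 'z) history \<Rightarrow> 'x belief_rewards measure) \<Rightarrow> bool" where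
  "conditional_law M k L bk \<pi> R \<longleftrightarrow>
     (\<lambda>z. R (bk, \<pi>, z)) \<in> obs_seqs M k L \<rightarrow>\<^sub>M prob_algebra (belief_reward_seqs M k L) \<and>
     trajectory_law M k L bk \<pi> =
       obs_law M k L bk \<pi> \<bind> (\<lambda>z.
         distr (R (bk, \<pi>, z)) (obs_seqs M k L \<Otimes>\<^sub>M belief_reward_seqs M k L) (Pair z))"


section \<open>Simplification and bounds\<close>

text \<open>
  A simplification operator turns the history and the original beliefs and rewards into random
  simplified beliefs and rewards; simplified belief updates are subsumed, since it produces the
  whole simplified belief sequence (including the simplified current belief). It acts after the
  observations are drawn, so it does not affect their law.
\<close>

type_synonym ('x, 'a, 'z) simplification =
  "('x, 'a, 'z) history \<Rightarrow> 'x belief_rewards \<Rightarrow> 'x belief_rewards measure"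

definition simplification_operator ::
  "('x, 'a, 'z) rho_pomdp \<Rightarrow> nat \<Rightarrow> nat \<Rightarrow> 'x measure \<Rightarrow> ('x, 'a) policies \<Rightarrow>
   ('x, 'a, 'z) simplification \<Rightarrow> bool" where
  "simplification_operator M k L bk \<pi> \<nu> \<longleftrightarrow>
     (\<lambda>(z, t). \<nu> (bk, \<pi>, z) t) \<in> obs_seqs M k L \<Otimes>\<^sub>M belief_reward_seqs M k L
       \<rightarrow>\<^sub>M prob_algebra (belief_reward_seqs M k L)"

text \<open>
  The conditional law of the pair (lower bound, upper bound) given the history and the original
  and simplified beliefs and rewards; no order between the two bounds is imposed.
\<close>

type_synonym ('x, 'a, 'z) bounds =
  "('x, 'a, 'z) history \<Rightarrow> 'x belief_rewards \<Rightarrow> 'x belief_rewards \<Rightarrow> (real \<times> real) measure"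

definition random_bounds ::
  "('x, 'a, 'z) rho_pomdp \<Rightarrow> nat \<Rightarrow> nat \<Rightarrow> 'x measure \<Rightarrow> ('x, 'a) policies \<Rightarrow>
   ('x, 'a, 'z) bounds \<Rightarrow> bool" where
  "random_bounds M k L bk \<pi> B \<longleftrightarrow>
     (\<lambda>(z, t, s). B (bk, \<pi>, z) t s)
       \<in> obs_seqs M k L \<Otimes>\<^sub>M belief_reward_seqs M k L \<Otimes>\<^sub>M belief_reward_seqs M k L
       \<rightarrow>\<^sub>M prob_algebra borel"

text \<open>
  Outcomes are tuples (original return, simplified return, lower bound, upper bound), and
  \<open>outcome_law\<close> is their conditional law given the history; \<open>G\<close> is the return as a function of
  the rewards.
\<close>

type_synonym outcome = "real \<times> real \<times> real \<times> real"

definition outcome_law ::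
  "((nat \<Rightarrow> real) \<Rightarrow> real) \<Rightarrow> (('x, 'a, 'z) history \<Rightarrow> 'x belief_rewards measure) \<Rightarrow>
   ('x, 'a, 'z) simplification \<Rightarrow> ('x, 'a, 'z) bounds \<Rightarrow> ('x, 'a, 'z) history \<Rightarrow>
   outcome measure" where
  "outcome_law G R \<nu> B H =
     R H \<bind> (\<lambda>t. \<nu> H t \<bind> (\<lambda>s. B H t s \<bind> (\<lambda>(l, u).
       return borel (G (snd t), G (snd s), l, u))))"

lemma outcome_law_measurable:
  assumes "(\<lambda>z. R (bk, \<pi>, z)) \<in> obs_seqs M k L \<rightarrow>\<^sub>M prob_algebra (belief_reward_seqs M k L)"
   and n: "simplification_operator M k L bk \<pi> \<nu>" and b: "random_bounds M k L bk \<pi> B"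
   and G: "G \<in> borel_measurable (reward_seqs k L)"
  shows "(\<lambda>z. outcome_law G R \<nu> B (bk, \<pi>, z)) \<in> obs_seqs M k L \<rightarrow>\<^sub>M prob_algebra borel"
proof -
  note [measurable] = assms(1) G n[unfolded simplification_operator_def]
  have [measurable]: "(\<lambda>((z, t), s). B (bk, \<pi>, z) t s)
       \<in> (obs_seqs M k L \<Otimes>\<^sub>M belief_reward_seqs M k L) \<Otimes>\<^sub>M belief_reward_seqs M k L
       \<rightarrow>\<^sub>M prob_algebra (borel \<Otimes>\<^sub>M borel)"
    using measurable_compose[OF _ b[unfolded random_bounds_def], of "\<lambda>((z,t),s). (z,t,s)"]
    by (simp add: borel_prod split_beta')
  have [measurable]: "snd \<in> belief_reward_seqs M k L \<rightarrow>\<^sub>M reward_seqs k L"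
    unfolding belief_reward_seqs_def by measurable
  show ?thesis
    unfolding outcome_law_def borel_prod[symmetric]
    apply (rule measurable_bind_prob_space2[OF assms(1)])
    unfolding split_beta'
    apply (rule measurable_bind_prob_space2[where N="belief_reward_seqs M k L"])
    subgoal using n[unfolded simplification_operator_def] by (simp add: split_beta')
    unfolding split_beta'
    apply (rule measurable_bind_prob_space2[where N="borel \<Otimes>\<^sub>M borel"])
    subgoal using \<open>(\<lambda>((z, t), s). B (bk, \<pi>, z) t s) \<in> _\<close> by (simp add: split_beta')
    unfolding split_beta' by measurable
qed

text \<open>
  Given both histories the two outcomes are independent and each depends on its own history only;
  the joint law integrates the product over the joint law \<open>Q\<close> of the observations.
\<close>

definition joint_outcome_law ::
  "((nat \<Rightarrow> real) \<Rightarrow> real) \<Rightarrow> (('x, 'a, 'z) history \<Rightarrow> 'x belief_rewards measure) \<Rightarrow>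
   ('x, 'a, 'z) simplification \<Rightarrow> ('x, 'a, 'z) bounds \<Rightarrow> ('x, 'a, 'z) bounds \<Rightarrow>
   ((nat \<Rightarrow> 'z) \<times> (nat \<Rightarrow> 'z)) measure \<Rightarrow> 'x measure \<Rightarrow>
   ('x, 'a) policies \<Rightarrow> ('x, 'a) policies \<Rightarrow> (outcome \<times> outcome) measure" where
  "joint_outcome_law G R \<nu> B B' Q bk \<pi> \<pi>' =
     Q \<bind> (\<lambda>(z, z'). outcome_law G R \<nu> B (bk, \<pi>, z) \<Otimes>\<^sub>M outcome_law G R \<nu> B' (bk, \<pi>', z'))"


section \<open>The loss and its bound\<close>

fun loss :: "outcome \<times> outcome \<Rightarrow> real" where
  "loss ((g, sg, l, u), (g', sg', l', u')) =
     (if sg - sg' > 0 then max (g' - g) 0 else if sg - sg' < 0 then max (g - g') 0 else 0)"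

fun loss_bound :: "outcome \<times> outcome \<Rightarrow> real" where
  "loss_bound ((g, sg, l, u), (g', sg', l', u')) =
     (if sg - sg' > 0 then max (u' - l) 0 else if sg - sg' < 0 then max (u - l') 0 else 0)"

definition loss_tail_bound :: "real \<Rightarrow> (outcome \<times> outcome) measure \<Rightarrow> real \<Rightarrow> real" where
  "loss_tail_bound \<alpha> P \<Delta> =
     min 1 (\<P>(\<omega> in P. loss_bound \<omega> > \<Delta>) / (1 - \<alpha>)\<^sup>2 + 2 * \<alpha> - \<alpha>\<^sup>2)"

end

theory Submission
  imports Defs
begin

text \<open>
  On the event \<open>E\<close> that both pairs of bounds hold the loss is at most its bound, so
  \<open>P(loss > \<Delta>) \<le> P(loss_bound > \<Delta>) + P(\<not> E)\<close>. Given the observations, \<open>E\<close> is a product event,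
  hence \<open>P(E) \<ge> (1 - \<alpha>)\<^sup>2\<close>. Dividing \<open>P(loss_bound > \<Delta>)\<close> by \<open>(1 - \<alpha>)\<^sup>2 \<le> 1\<close> only weakens the estimate.
\<close>

text \<open>A set rather than a predicate, so that joint validity of both pairs is the rectangle
  \<open>bounds_hold \<times> bounds_hold\<close>, whose probability factors under a product
  measure.\<close>

definition bounds_hold :: "outcome set" where
  "bounds_hold = {(g, sg, l, u). l \<le> g \<and> g \<le> u}"

lemma bounds_hold_sets [measurable]: "bounds_hold \<in> sets borel"
proof -
  have "bounds_hold = {w. fst (snd (snd w)) \<le> fst w \<and> fst w \<le> snd (snd (snd w))}"
    by (auto simp: bounds_hold_def)
  \<comment> \<open>\<open>borel\<close> here belongs to the product topology on
    \<open>outcome\<close>, so closedness is enough.\<close>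
  also have "\<dots> \<in> sets borel"
    by (intro borel_closed closed_Collect_conj closed_Collect_le continuous_intros)
  finally show ?thesis .
qed

text \<open>Both functions select their branch by the simplified returns alone, so the same branch
  is compared: \<open>g' - g\<close> with \<open>u' - l\<close>, or \<open>g - g'\<close> with
  \<open>u - l'\<close>.\<close>

lemma loss_le_loss_bound:
  assumes "w \<in> bounds_hold \<times> bounds_hold"
  shows "loss w \<le> loss_bound w"
  using assms by (cases w rule: loss.cases) (auto simp: bounds_hold_def)

lemma loss_measurable [measurable]: "loss \<in> borel_measurable (borel \<Otimes>\<^sub>M borel)"
proof -
  \<comment> \<open>As a single abstraction, the pattern match becomes a term in projections from a
    product of real Borel spaces.\<close>
  have eq: "loss = (\<lambda>((g, sg, l, u), (g', sg', l', u')).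
      if sg - sg' > 0 then max (g' - g) 0 else if sg - sg' < 0 then max (g - g') 0 else 0)"
    by (auto simp: fun_eq_iff)
  show ?thesis
    unfolding borel_prod[symmetric] eq split_beta' by measurable
qed

lemma loss_bound_measurable [measurable]: "loss_bound \<in> borel_measurable (borel \<Otimes>\<^sub>M borel)"
proof -
  have eq: "loss_bound = (\<lambda>((g, sg, l, u), (g', sg', l', u')).
      if sg - sg' > 0 then max (u' - l) 0 else if sg - sg' < 0 then max (u - l') 0 else 0)"
    by (auto simp: fun_eq_iff)
  show ?thesis
    unfolding borel_prod[symmetric] eq split_beta' by measurable
qed

text \<open>Conditional independence is encoded as a product of kernels; binding it to the
  observation law requires the product to be a kernel too.\<close>

lemma pair_kernel_measurable:
  assumes "f \<in> M \<rightarrow>\<^sub>M prob_algebra S" and "g \<in> N \<rightarrow>\<^sub>M prob_algebra T"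
  shows "(\<lambda>(x, y). f x \<Otimes>\<^sub>M g y) \<in> M \<Otimes>\<^sub>M N \<rightarrow>\<^sub>M prob_algebra (S \<Otimes>\<^sub>M T)"
  using assms unfolding split_beta' by measurable

text \<open>The mass of \<open>E\<close> under the mixture is the \<open>Q\<close>-average of its
  masses under \<open>K x\<close>, and \<open>Q\<close> has total mass 1.\<close>

lemma measure_bind_ge:
  assumes Q: "Q \<in> space (prob_algebra S)" and K: "K \<in> S \<rightarrow>\<^sub>M prob_algebra T"
    and E: "E \<in> sets T" and ge: "AE x in Q. c \<le> measure (K x) E"
  shows "c \<le> measure (Q \<bind> K) E"
proof -
  have Q': "prob_space Q" "sets Q = sets S"
    using Q by (auto simp: space_prob_algebra)
  interpret Q: prob_space Q by fact
  interpret P: prob_space "Q \<bind> K" by (rule prob_space_bind'[OF Q K])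
  have KQ: "K \<in> Q \<rightarrow>\<^sub>M subprob_algebra T"
    using K Q'(2) by (simp add: measurable_prob_algebraD cong: measurable_cong_sets)
  have "ennreal c = (\<integral>\<^sup>+x. ennreal c \<partial>Q)"
    by (simp add: Q.emeasure_space_1)
  also have "\<dots> \<le> (\<integral>\<^sup>+x. emeasure (K x) E \<partial>Q)"
  proof (rule nn_integral_mono_AE)
    show "AE x in Q. ennreal c \<le> emeasure (K x) E"
      using ge AE_space
    proof eventually_elim
      case (elim x)
      interpret Kx: subprob_space "K x"
        using subprob_space_kernel[OF KQ] elim by blast
      show ?case using elim by (simp add: Kx.emeasure_eq_measure ennreal_leI)
    qed
  qed
  also have "\<dots> = emeasure (Q \<bind> K) E"
    by (rule emeasure_bind[OF Q.not_empty KQ E, symmetric])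
  \<comment> \<open>Negative \<open>c\<close>, truncated by \<open>ennreal\<close>, is harmless: a
    measure is nonnegative.\<close>
  finally show ?thesis
    by (simp add: P.emeasure_eq_measure)
qed

lemma measure_pair_Times:
  assumes "prob_space M" and "prob_space N" and "A \<in> sets M" and "B \<in> sets N"
  shows "measure (M \<Otimes>\<^sub>M N) (A \<times> B) = measure M A * measure N B"
proof -
  interpret M: prob_space M by fact
  interpret N: prob_space N by fact
  show ?thesis
    using N.emeasure_pair_measure_Times[OF assms(3,4)]
    by (simp add: measure_def enn2real_mult)
qed

text \<open>The model-free part: the joint law enters only through the mass it gives to the event
  that both pairs of bounds hold.\<close>

lemma loss_tail_le:
  fixes M :: "(outcome \<times> outcome) measure"
  assumes "prob_space M" and sets_M: "sets M = sets (borel \<Otimes>\<^sub>M borel)" and \<alpha>: "0 \<le> \<alpha>" "\<alpha> < 1"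
    and E: "(1 - \<alpha>)\<^sup>2 \<le> measure M (bounds_hold \<times> bounds_hold)"
  shows "\<P>(w in M. loss w > \<Delta>) \<le> loss_tail_bound \<alpha> M \<Delta>"
proof -
  interpret prob_space M by fact
  note [measurable_cong] = sets_M
  let ?E = "bounds_hold \<times> bounds_hold" and ?p = "\<P>(w in M. loss_bound w > \<Delta>)"
  have E_sets: "?E \<in> events"
    unfolding sets_M by (intro pair_measureI bounds_hold_sets)
  have "\<P>(w in M. loss w > \<Delta>) \<le> prob ({w \<in> space M. loss_bound w > \<Delta>} \<union> (space M - ?E))"
    by (rule finite_measure_mono) (use E_sets in \<open>auto dest: order.strict_trans2[OF _ loss_le_loss_bound]\<close>)
  also have "\<dots> \<le> ?p + prob (space M - ?E)"
    by (rule measure_Un_le) (use E_sets in auto)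
  also have "\<dots> \<le> ?p + (1 - (1 - \<alpha>)\<^sup>2)"
    using E prob_compl[OF E_sets] by simp
  also have "\<dots> \<le> ?p / (1 - \<alpha>)\<^sup>2 + (1 - (1 - \<alpha>)\<^sup>2)"
  proof -
    have "0 < (1 - \<alpha>)\<^sup>2" "(1 - \<alpha>)\<^sup>2 \<le> 1"
      using \<alpha> by (auto intro: power_le_one)
    then have "?p * (1 - \<alpha>)\<^sup>2 \<le> ?p"
      by (intro mult_left_le) auto
    with \<open>0 < (1 - \<alpha>)\<^sup>2\<close> show ?thesis
      by (simp add: pos_le_divide_eq)
  qed
  \<comment> \<open>\<open>1 - (1 - \<alpha>)\<^sup>2\<close> expands to
    \<open>2 * \<alpha> - \<alpha>\<^sup>2\<close>; the cap 1 in \<open>loss_tail_bound\<close> is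
    met because the left side is a probability.\<close>
  finally show ?thesis
    by (simp add: loss_tail_bound_def power2_eq_square algebra_simps)
qed

theorem theorem3:
  fixes M :: "('x, 'a, 'z) rho_pomdp"
    and k L :: nat
    and bk :: "'x measure"
    and \<pi> \<pi>' :: "('x, 'a) policies"
    and Q :: "((nat \<Rightarrow> 'z) \<times> (nat \<Rightarrow> 'z)) measure"
    and R :: "('x, 'a, 'z) history \<Rightarrow> 'x belief_rewards measure"
    and G :: "(nat \<Rightarrow> real) \<Rightarrow> real"
    and \<nu> :: "('x, 'a, 'z) simplification"
    and B B' :: "('x, 'a, 'z) bounds"
    and \<alpha> \<Delta> :: real
  assumes "rho_pomdp M"
    and "bk \<in> space (belief_space M)"
    and "policy_sequence M k L \<pi>" and "policy_sequence M k L \<pi>'"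
    and "joint_obs_law M k L bk \<pi> \<pi>' Q"
    and "conditional_law M k L bk \<pi> R" and "conditional_law M k L bk \<pi>' R"
    and "G \<in> borel_measurable (reward_seqs k L)"
    and "simplification_operator M k L bk \<pi> \<nu>" and "simplification_operator M k L bk \<pi>' \<nu>"
    and "random_bounds M k L bk \<pi> B" and "random_bounds M k L bk \<pi>' B'"
    and "0 \<le> \<alpha>" and "\<alpha> < 1"
    and "AE (z, z') in Q.
           \<P>((g, sg, l, u) in outcome_law G R \<nu> B (bk, \<pi>, z). l \<le> g \<and> g \<le> u) \<ge> 1 - \<alpha> \<and>
           \<P>((g', sg', l', u') in outcome_law G R \<nu> B' (bk, \<pi>', z'). l' \<le> g' \<and> g' \<le> u') \<ge> 1 - \<alpha>"
  shows "\<P>(\<omega> in joint_outcome_law G R \<nu> B B' Q bk \<pi> \<pi>'. loss \<omega> > \<Delta>)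
           \<le> loss_tail_bound \<alpha> (joint_outcome_law G R \<nu> B B' Q bk \<pi> \<pi>') \<Delta> \<and>
         \<P>(\<omega> in joint_outcome_law G R \<nu> B B' Q bk \<pi> \<pi>'. loss \<omega> \<le> \<Delta>)
           \<ge> 1 - loss_tail_bound \<alpha> (joint_outcome_law G R \<nu> B B' Q bk \<pi> \<pi>') \<Delta>"
proof -
  let ?S = "obs_seqs M k L"
  let ?O = "\<lambda>z. outcome_law G R \<nu> B (bk, \<pi>, z)" and ?O' = "\<lambda>z. outcome_law G R \<nu> B' (bk, \<pi>', z)"
  let ?K = "\<lambda>(z, z'). ?O z \<Otimes>\<^sub>M ?O' z'"
  let ?P = "joint_outcome_law G R \<nu> B B' Q bk \<pi> \<pi>'"
  have Q: "Q \<in> space (prob_algebra (?S \<Otimes>\<^sub>M ?S))"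
    using assms(5) by (simp add: joint_obs_law_def)
  have O: "?O \<in> ?S \<rightarrow>\<^sub>M prob_algebra borel" and O': "?O' \<in> ?S \<rightarrow>\<^sub>M prob_algebra borel"
    using assms(6-12) by (auto intro!: outcome_law_measurable simp: conditional_law_def)
  have K: "?K \<in> ?S \<Otimes>\<^sub>M ?S \<rightarrow>\<^sub>M prob_algebra (borel \<Otimes>\<^sub>M borel)"
    by (rule pair_kernel_measurable[OF O O'])
  have P: "prob_space ?P" "sets ?P = sets (borel \<Otimes>\<^sub>M borel)"
    unfolding joint_outcome_law_def
    using prob_space_bind'[OF Q K] sets_bind'[OF Q K] by simp_all
  interpret P: prob_space ?P by (rule P(1))
  have sets_Q: "sets Q = sets (?S \<Otimes>\<^sub>M ?S)"
    using Q by (simp add: space_prob_algebra)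
  have "AE x in Q. (1 - \<alpha>)\<^sup>2 \<le> measure (?K x) (bounds_hold \<times> bounds_hold)"
    using assms(15) AE_space
  proof eventually_elim
    case (elim x)
    obtain z z' where x: "x = (z, z')" by (cases x)
    have z: "z \<in> space ?S" "z' \<in> space ?S"
      using elim(2) x sets_eq_imp_space_eq[OF sets_Q] by (auto simp: space_pair_measure)
    have Oz: "prob_space (?O z)" "sets (?O z) = sets borel"
      and Oz': "prob_space (?O' z')" "sets (?O' z') = sets borel"
      using measurable_space[OF O z(1)] measurable_space[OF O' z(2)]
      by (auto simp: space_prob_algebra)
    \<comment> \<open>Both outcome laws live on the whole type, so the events in the hypothesis are
      exactly \<open>bounds_hold\<close>.\<close>
    have "1 - \<alpha> \<le> measure (?O z) bounds_hold" "1 - \<alpha> \<le> measure (?O' z') bounds_hold"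
      using elim(1) sets_eq_imp_space_eq[OF Oz(2)] sets_eq_imp_space_eq[OF Oz'(2)]
      by (simp_all add: x bounds_hold_def)
    \<comment> \<open>Multiplying the two estimates uses
      \<open>1 - \<alpha> \<ge> 0\<close>.\<close>
    then have "(1 - \<alpha>)\<^sup>2 \<le> measure (?O z) bounds_hold * measure (?O' z') bounds_hold"
      using assms(14) unfolding power2_eq_square by (intro mult_mono) auto
    also have "\<dots> = measure (?K x) (bounds_hold \<times> bounds_hold)"
      using Oz Oz' by (simp add: x measure_pair_Times)
    finally show ?case .
  qed
  then have "(1 - \<alpha>)\<^sup>2 \<le> measure ?P (bounds_hold \<times> bounds_hold)"
    unfolding joint_outcome_law_def
    by (intro measure_bind_ge[OF Q K] pair_measureI bounds_hold_sets)
  then have tail: "\<P>(\<omega> in ?P. loss \<omega> > \<Delta>) \<le> loss_tail_bound \<alpha> ?P \<Delta>"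
    by (rule loss_tail_le[OF P assms(13,14)])
  note [measurable_cong] = P(2)
  have "{\<omega> \<in> space ?P. loss \<omega> > \<Delta>} \<in> sets ?P"
    by measurable
  \<comment> \<open>The second claim is the first one read on the complementary event.\<close>
  then have "\<P>(\<omega> in ?P. loss \<omega> \<le> \<Delta>) = 1 - \<P>(\<omega> in ?P. loss \<omega> > \<Delta>)"
    using P.prob_neg[of "\<lambda>\<omega>. loss \<omega> > \<Delta>"] by (simp add: not_less)
  with tail show ?thesis by simp
qed

end
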